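(* For every digraph $G$ the following are equivalent: (1) $G$ is a DAG; (2) $\mathrm{d\text{-}vsn}(G)=0$; (3) $\mathrm{d\text{-}pw}(G)=0$; (4) $\mathrm{d\text{-}cutw}(G)=0$.
   Context: Digraphs $G=(V,E)$ are finite with $E\subseteq\{(u,v):u\ne v\}$. A DAG is a digraph containing no directed cycle (of any length $\ge2$) as a subdigraph. A layout is a bijection $\varphi:V\to\{1,\dots,|V|\}$; $L(i,\varphi)=\{u:\varphi(u)\le i\}$, $R(i,\varphi)=\{u:\varphi(u)>i\}$. $\mathrm{d\text{-}vsn}(G)=\min_\varphi\max_i|\{u\in L(i,\varphi):\exists v\in R(i,\varphi),(v,u)\in E\}|$. $\mathrm{d\text{-}pw}(G)$ is the minimum of $\max|X_i|-1$ over sequences $(X_1,\dots,X_r)$ of subsets of $V$ with $\bigcup X_i=V$, for each $(u,v)\in E$ some $i\le j$ with $u\in X_i,v\in X_j$, and $X_i\cap X_\ell\subseteq X_j$ for $i<j<\ell$. $\mathrm{d\text{-}cutw}(G)=\min_\varphi\max_i|\{(u,v)\in E:u\in L(i,\varphi),v\in R(i,\varphi)\}|$. *)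

theory Defs
  imports "Graph_Theory.Graph_Theory"
begin

text \<open>Digraphs are the pair digraphs of the library: the locale \<open>pair_digraph\<close> says that
  the vertex set and the arc set are finite, arcs are ordered pairs of vertices, and there are
  no loops.\<close>

definition dag :: "'a pair_pre_digraph \<Rightarrow> bool" where
  "dag G \<longleftrightarrow> \<not> (\<exists>p. pre_digraph.cycle (with_proj G) p \<and> 2 \<le> length p)"

text \<open>A layout is a bijection on the vertex set; its values outside are irrelevant.\<close>

definition layouts :: "'a pair_pre_digraph \<Rightarrow> ('a \<Rightarrow> nat) set" where
  "layouts G = {\<phi>. bij_betw \<phi> (pverts G) {1..card (pverts G)}}"

definition left_part :: "'a pair_pre_digraph \<Rightarrow> nat \<Rightarrow> ('a \<Rightarrow> nat) \<Rightarrow> 'a set" where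
  "left_part G i \<phi> = {u \<in> pverts G. \<phi> u \<le> i}"

definition right_part :: "'a pair_pre_digraph \<Rightarrow> nat \<Rightarrow> ('a \<Rightarrow> nat) \<Rightarrow> 'a set" where
  "right_part G i \<phi> = {u \<in> pverts G. \<phi> u > i}"

text \<open>The positions \<open>i\<close> below start at 0. There the left part is empty, so position 0 contributes
  the value 0 and never changes the maximum; it only gives the null digraph a nonempty range
  of positions.\<close>

definition vsn_cut :: "'a pair_pre_digraph \<Rightarrow> ('a \<Rightarrow> nat) \<Rightarrow> nat \<Rightarrow> 'a set" where
  "vsn_cut G \<phi> i = {u \<in> left_part G i \<phi>. \<exists>v \<in> right_part G i \<phi>. (v, u) \<in> parcs G}"

definition d_vsn :: "'a pair_pre_digraph \<Rightarrow> nat" where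
  "d_vsn G = (MIN \<phi>\<in>layouts G. MAX i\<in>{0..card (pverts G)}. card (vsn_cut G \<phi> i))"

definition arc_cut :: "'a pair_pre_digraph \<Rightarrow> ('a \<Rightarrow> nat) \<Rightarrow> nat \<Rightarrow> ('a \<times> 'a) set" where
  "arc_cut G \<phi> i = {(u, v) \<in> parcs G. u \<in> left_part G i \<phi> \<and> v \<in> right_part G i \<phi>}"

definition d_cutw :: "'a pair_pre_digraph \<Rightarrow> nat" where
  "d_cutw G = (MIN \<phi>\<in>layouts G. MAX i\<in>{0..card (pverts G)}. card (arc_cut G \<phi> i))"

definition directed_path_decomposition :: "'a pair_pre_digraph \<Rightarrow> 'a set list \<Rightarrow> bool" where
  "directed_path_decomposition G Xs \<longleftrightarrow>
     Xs \<noteq> [] \<and>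
     (\<forall>X \<in> set Xs. X \<subseteq> pverts G) \<and>
     \<Union> (set Xs) = pverts G \<and>
     (\<forall>(u, v) \<in> parcs G. \<exists>i j. i \<le> j \<and> j < length Xs \<and> u \<in> Xs ! i \<and> v \<in> Xs ! j) \<and>
     (\<forall>i j l. i < j \<and> j < l \<and> l < length Xs \<longrightarrow> Xs ! i \<inter> Xs ! l \<subseteq> Xs ! j)"

text \<open>If there is at least one vertex, then some bag is nonempty and the subtraction on \<open>nat\<close> is
  exact. The null digraph, whose bags are all empty, gets the value 0.\<close>

definition d_pw :: "'a pair_pre_digraph \<Rightarrow> nat" where
  "d_pw G = (MIN Xs\<in>{Xs. directed_path_decomposition G Xs}. (MAX X\<in>set Xs. card X) - 1)"

text \<open>The minima and maxima range over finite nonempty sets of numbers, so they are attained.\<close>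

lemma layouts_nonempty:
  assumes "pair_digraph G" shows "layouts G \<noteq> {}"
proof -
  interpret pair_digraph G by fact
  have "\<exists>\<phi>. bij_betw \<phi> (pverts G) {1..card (pverts G)}"
    using pair_finite_verts by (intro finite_same_card_bij) auto
  then show ?thesis by (auto simp: layouts_def)
qed

lemma d_vsn_range_finite:
  assumes "pair_digraph G"
  shows "finite ((\<lambda>\<phi>. MAX i\<in>{0..card (pverts G)}. card (vsn_cut G \<phi> i)) ` layouts G)"
proof -
  interpret pair_digraph G by fact
  have "card (vsn_cut G \<phi> i) \<le> card (pverts G)" for \<phi> i
    using pair_finite_verts by (intro card_mono) (auto simp: vsn_cut_def left_part_def)
  then have "(\<lambda>\<phi>. MAX i\<in>{0..card (pverts G)}. card (vsn_cut G \<phi> i)) ` layouts G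
      \<subseteq> {..card (pverts G)}"
    by auto
  then show ?thesis by (rule finite_subset) simp
qed

lemma d_cutw_range_finite:
  assumes "pair_digraph G"
  shows "finite ((\<lambda>\<phi>. MAX i\<in>{0..card (pverts G)}. card (arc_cut G \<phi> i)) ` layouts G)"
proof -
  interpret pair_digraph G by fact
  have "card (arc_cut G \<phi> i) \<le> card (parcs G)" for \<phi> i
    using pair_finite_arcs by (intro card_mono) (auto simp: arc_cut_def)
  then have "(\<lambda>\<phi>. MAX i\<in>{0..card (pverts G)}. card (arc_cut G \<phi> i)) ` layouts G
      \<subseteq> {..card (parcs G)}"
    by auto
  then show ?thesis by (rule finite_subset) simp
qed

lemma directed_path_decomposition_exists:
  assumes "pair_digraph G" shows "directed_path_decomposition G [pverts G]"
proof -
  interpret pair_digraph G by fact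
  show ?thesis
    by (auto simp: directed_path_decomposition_def dest: in_arcsD1 in_arcsD2)
qed

lemma d_pw_range_finite:
  assumes "pair_digraph G"
  shows "finite ((\<lambda>Xs. (MAX X\<in>set Xs. card X) - 1) ` {Xs. directed_path_decomposition G Xs})"
proof -
  interpret pair_digraph G by fact
  have "(MAX X\<in>set Xs. card X) - 1 \<le> card (pverts G)"
    if "directed_path_decomposition G Xs" for Xs
  proof -
    have "(MAX X\<in>set Xs. card X) \<le> card (pverts G)"
      using that pair_finite_verts
      by (subst Max_le_iff) (auto simp: directed_path_decomposition_def intro!: card_mono)
    then show ?thesis by simp
  qed
  then have "(\<lambda>Xs. (MAX X\<in>set Xs. card X) - 1) ` {Xs. directed_path_decomposition G Xs}
      \<subseteq> {..card (pverts G)}"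
    by auto
  then show ?thesis by (rule finite_subset) simp
qed

end

theory Submission
  imports Defs
begin

text \<open>All four conditions say that the vertices can be ranked so that every arc increases the
  rank. A vanishing vertex separation number means that no arc goes backwards in some layout,
  a vanishing cutwidth that no arc goes forwards in some layout, that is, in the reversed layout
  none goes backwards. The bags of a decomposition of width 0 are singletons or empty, and the
  index of the first bag containing a vertex serves as its rank.\<close>

section \<open>Vanishing minima and maxima of natural numbers\<close>

text \<open>Finiteness is asked of the image rather than of \<open>A\<close>: the sets of layouts
  and of decompositions can be infinite, while the widths they yield are bounded.\<close>

lemma Min_nat_image_eq_0_iff:
  fixes f :: "'a \<Rightarrow> nat"
  assumes "finite (f ` A)" "A \<noteq> {}"
  shows "(MIN x\<in>A. f x) = 0 \<longleftrightarrow> (\<exists>x\<in>A. f x = 0)"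
proof -
  have "(MIN x\<in>A. f x) \<le> 0 \<longleftrightarrow> (\<exists>x\<in>A. f x \<le> 0)"
    using assms by (subst Min_le_iff) auto
  then show ?thesis by simp
qed

lemma Max_nat_image_eq_0_iff:
  fixes f :: "'a \<Rightarrow> nat"
  assumes "finite A" "A \<noteq> {}"
  shows "(MAX x\<in>A. f x) = 0 \<longleftrightarrow> (\<forall>x\<in>A. f x = 0)"
proof -
  have "(MAX x\<in>A. f x) \<le> 0 \<longleftrightarrow> (\<forall>x\<in>A. f x \<le> 0)"
    using assms by (subst Max_le_iff) auto
  then show ?thesis by simp
qed

section \<open>Rankings and topological sorting\<close>

lemma acyclic_if_ranking:
  fixes f :: "'a \<Rightarrow> nat"
  assumes "\<And>u v. (u, v) \<in> r \<Longrightarrow> f u < f v"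
  shows "acyclic r"
proof -
  have "r \<subseteq> measure f"
    using assms by auto
  then show ?thesis
    using wf_acyclic[OF wf_measure] acyclic_subset by blast
qed

text \<open>The elements are inserted in order of nondecreasing \<open>g\<close>, and each new one
  receives the next free position at the end.\<close>

lemma enumeration_refining_rank:
  fixes g :: "'a \<Rightarrow> nat"
  assumes "finite V"
  shows "\<exists>\<phi>. bij_betw \<phi> V {1..card V} \<and> (\<forall>u\<in>V. \<forall>v\<in>V. g u < g v \<longrightarrow> \<phi> u < \<phi> v)"
  using assms
proof (induction V rule: finite_ranking_induct[where f = g])
  case empty
  then show ?case by (simp add: bij_betw_def)
next
  case (insert x S)
  show ?case
  \<comment> \<open>The induction rule allows \<open>x\<close> to be in \<open>S\<close>
    already.\<close>
  proof (cases "x \<in> S")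
    case True
    then show ?thesis
      using insert.IH by (simp add: insert_absorb)
  next
    case False
    obtain \<phi> where \<phi>: "bij_betw \<phi> S {1..card S}"
      and mono: "\<And>u v. u \<in> S \<Longrightarrow> v \<in> S \<Longrightarrow> g u < g v \<Longrightarrow> \<phi> u < \<phi> v"
      using insert.IH by blast
    define \<psi> where "\<psi> = \<phi>(x := Suc (card S))"
    have "bij_betw \<psi> S {1..card S}"
      using \<phi> False by (subst bij_betw_cong[of _ _ \<phi>]) (auto simp: \<psi>_def)
    then have "bij_betw \<psi> (S \<union> {x}) ({1..card S} \<union> {\<psi> x})"
      using False by (intro notIn_Un_bij_betw) (auto simp: \<psi>_def)
    moreover have "{1..card S} \<union> {\<psi> x} = {1..card (insert x S)}"
      using False insert.hyps(1) by (auto simp: \<psi>_def)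
    ultimately have "bij_betw \<psi> (insert x S) {1..card (insert x S)}"
      by simp
    moreover have "\<psi> u < \<psi> v" if "u \<in> insert x S" "v \<in> insert x S" "g u < g v" for u v
    proof -
      \<comment> \<open>\<open>x\<close> has the largest rank so far, so it cannot be the element of
        strictly smaller rank.\<close>
      have "u \<in> S"
        using that insert.hyps(2) by force
      moreover have "\<phi> u \<le> card S"
        using bij_betwE[OF \<phi>] \<open>u \<in> S\<close> by auto
      ultimately show ?thesis
        using that mono False by (auto simp: \<psi>_def)
    qed
    ultimately show ?thesis by blast
  qed
qed

text \<open>Rank each vertex by its number of ancestors. Along an arc from \<open>u\<close> to
  \<open>v\<close> every ancestor of \<open>u\<close> is one of \<open>v\<close>; moreover
  \<open>u\<close> is an ancestor of \<open>v\<close> but, by acyclicity, not of itself, so the rank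
  strictly increases.\<close>

lemma topological_sort_exists:
  assumes "finite V" "r \<subseteq> V \<times> V" "acyclic r"
  shows "\<exists>\<phi>. bij_betw \<phi> V {1..card V} \<and> (\<forall>(u, v)\<in>r. \<phi> u < \<phi> v)"
proof -
  define g where "g v = card {u. (u, v) \<in> r\<^sup>+}" for v
  have trancl_sub: "r\<^sup>+ \<subseteq> V \<times> V"
    using assms(2) by (rule trancl_subset_Sigma)
  have "g u < g v" if "(u, v) \<in> r" for u v
    unfolding g_def
  proof (rule psubset_card_mono)
    show "finite {w. (w, v) \<in> r\<^sup>+}"
      using assms(1) trancl_sub by (rule_tac finite_subset[of _ V]) auto
    have "{w. (w, u) \<in> r\<^sup>+} \<subseteq> {w. (w, v) \<in> r\<^sup>+}"
      using that by (auto intro: trancl.trancl_into_trancl)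
    moreover have "(u, u) \<notin> r\<^sup>+"
      using assms(3) by (simp add: acyclic_def)
    ultimately show "{w. (w, u) \<in> r\<^sup>+} \<subset> {w. (w, v) \<in> r\<^sup>+}"
      using that by blast
  qed
  then show ?thesis
    using enumeration_refining_rank[OF assms(1), of g] assms(2) by fast
qed

section \<open>Layouts and their reversal\<close>

lemma layouts_iff: "\<phi> \<in> layouts G \<longleftrightarrow> bij_betw \<phi> (pverts G) {1..card (pverts G)}"
  by (simp add: layouts_def)

text \<open>Positions run from 1 to n, so subtracting them from n + 1 is an involution. It turns
  backward arcs into forward ones, as the cutwidth requires.\<close>

lemma reverse_layout:
  assumes "\<phi> \<in> layouts G"
  shows "(\<lambda>v. Suc (card (pverts G)) - \<phi> v) \<in> layouts G"
proof -
  let ?n = "card (pverts G)"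
  have "bij_betw (\<lambda>i. Suc ?n - i) {1..?n} {1..?n}"
    by (rule bij_betw_byWitness[where f' = "\<lambda>i. Suc ?n - i"]) auto
  from bij_betw_trans[OF assms[unfolded layouts_iff] this] show ?thesis
    by (simp add: layouts_iff comp_def)
qed

section \<open>Directed cycles and acyclicity of the arc relation\<close>

context pair_digraph
begin

lemma arc_neq: "(u, v) \<in> parcs G \<Longrightarrow> u \<noteq> v"
  using no_loops[of "(u, v)"] by simp

text \<open>A vertex related to itself in the transitive closure lies on a nonempty closed walk, and
  such a walk contains a cycle; conversely a cycle is itself such a walk.\<close>

lemma dag_iff_acyclic: "dag G \<longleftrightarrow> acyclic (parcs G)"
proof
  assume "dag G"
  show "acyclic (parcs G)"
    unfolding acyclic_def
  proof (intro allI notI)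
    fix u assume "(u, u) \<in> (parcs G)\<^sup>+"
    then obtain p where "awalk u p u" "p \<noteq> []"
      using reachable1_awalk[of u u] by auto
    then obtain q where q: "cycle q"
      using closed_w_imp_cycle[of p] by (auto simp: closed_w_def)
    then obtain w where w: "awalk w q w" "q \<noteq> []"
      by (auto simp: cycle_def)
    \<comment> \<open>A cycle of length 1 would be a loop.\<close>
    have "length q \<noteq> 1"
    proof
      assume "length q = 1"
      then obtain e where "q = [e]"
        by (auto simp: length_Suc_conv)
      with w have "e \<in> parcs G" "fst e = snd e"
        by (auto simp: awalk_simps)
      then show False
        using arc_neq[of "fst e" "snd e"] by simp
    qed
    moreover have "length q \<noteq> 0"
      using w by simp
    ultimately have "2 \<le> length q"
      by linarith
    then show False
      using \<open>dag G\<close> q unfolding dag_def by blast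
  qed
next
  assume "acyclic (parcs G)"
  moreover have "(u, u) \<in> (parcs G)\<^sup>+" if "awalk u p u" "p \<noteq> []" for u p
    using that reachable1_awalk[of u u] by auto
  ultimately show "dag G"
    by (auto simp: dag_def cycle_def acyclic_def)
qed

lemma acyclic_iff_ex_layout:
  "acyclic (parcs G) \<longleftrightarrow> (\<exists>\<phi>\<in>layouts G. \<forall>(u, v)\<in>parcs G. \<phi> u < \<phi> v)"
proof
  assume "acyclic (parcs G)"
  moreover have "parcs G \<subseteq> pverts G \<times> pverts G"
    using in_arcsD1 in_arcsD2 by auto
  ultimately show "\<exists>\<phi>\<in>layouts G. \<forall>(u, v)\<in>parcs G. \<phi> u < \<phi> v"
    using topological_sort_exists[OF pair_finite_verts] unfolding layouts_def by blast
next
  assume "\<exists>\<phi>\<in>layouts G. \<forall>(u, v)\<in>parcs G. \<phi> u < \<phi> v"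
  then obtain \<phi> where "\<phi> \<in> layouts G" "\<forall>(u, v)\<in>parcs G. \<phi> u < \<phi> v" ..
  from this(2) show "acyclic (parcs G)"
    by (intro acyclic_if_ranking[of _ \<phi>]) auto
qed

section \<open>Layouts whose cuts are all empty\<close>

lemma layout_le_card:
  assumes "\<phi> \<in> layouts G" "v \<in> pverts G"
  shows "\<phi> v \<le> card (pverts G)"
  using assms bij_betwE[of \<phi>] by (fastforce simp: layouts_iff)

lemma layout_arc_neq:
  assumes "\<phi> \<in> layouts G" "(u, v) \<in> parcs G"
  shows "\<phi> u \<noteq> \<phi> v"
proof
  assume "\<phi> u = \<phi> v"
  then have "u = v"
    using assms in_arcsD1 in_arcsD2 by (auto simp: layouts_iff bij_betw_def dest: inj_onD)
  then show False
    using arc_neq[OF assms(2)] by simp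
qed

text \<open>The cut collects heads of arcs running from right to left. A backward arc is detected at
  the position of its head.\<close>

lemma vsn_cuts_empty_iff:
  assumes "\<phi> \<in> layouts G"
  shows "(\<forall>i\<in>{0..card (pverts G)}. card (vsn_cut G \<phi> i) = 0) \<longleftrightarrow>
    (\<forall>(u, v)\<in>parcs G. \<phi> u < \<phi> v)" (is "?L \<longleftrightarrow> ?R")
proof
  \<comment> \<open>Cardinality 0 yields emptiness only for finite sets.\<close>
  have fin: "finite (vsn_cut G \<phi> i)" for i
    using pair_finite_verts by (rule rev_finite_subset) (auto simp: vsn_cut_def left_part_def)
  assume L: ?L
  have "\<phi> u < \<phi> v" if a: "(u, v) \<in> parcs G" for u v
  proof (rule ccontr)
    assume "\<not> \<phi> u < \<phi> v"
    with layout_arc_neq[OF assms a] have "\<phi> v < \<phi> u" by simp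
    then have "v \<in> vsn_cut G \<phi> (\<phi> v)"
      using a in_arcsD1[OF a] in_arcsD2[OF a]
      by (auto simp: vsn_cut_def left_part_def right_part_def)
    moreover have "\<phi> v \<in> {0..card (pverts G)}"
      using layout_le_card[OF assms in_arcsD2[OF a]] by simp
    ultimately show False
      using L fin by auto
  qed
  then show ?R by blast
next
  assume ?R
  then have "vsn_cut G \<phi> i = {}" for i
    by (fastforce simp: vsn_cut_def left_part_def right_part_def)
  then show ?L by simp
qed

text \<open>The orientation is opposite to that of \<open>vsn_cut\<close>: arcs from left to right
  are counted, so a forward arc is the obstruction, detected at the position of its tail.\<close>

lemma arc_cuts_empty_iff:
  assumes "\<phi> \<in> layouts G"
  shows "(\<forall>i\<in>{0..card (pverts G)}. card (arc_cut G \<phi> i) = 0) \<longleftrightarrow>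
    (\<forall>(u, v)\<in>parcs G. \<phi> v < \<phi> u)" (is "?L \<longleftrightarrow> ?R")
proof
  have fin: "finite (arc_cut G \<phi> i)" for i
    using pair_finite_arcs by (rule rev_finite_subset) (auto simp: arc_cut_def)
  assume L: ?L
  have "\<phi> v < \<phi> u" if a: "(u, v) \<in> parcs G" for u v
  proof (rule ccontr)
    assume "\<not> \<phi> v < \<phi> u"
    with layout_arc_neq[OF assms a] have "\<phi> u < \<phi> v" by simp
    then have "(u, v) \<in> arc_cut G \<phi> (\<phi> u)"
      using a in_arcsD1[OF a] in_arcsD2[OF a]
      by (auto simp: arc_cut_def left_part_def right_part_def)
    moreover have "\<phi> u \<in> {0..card (pverts G)}"
      using layout_le_card[OF assms in_arcsD1[OF a]] by simp
    ultimately show False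
      using L fin by auto
  qed
  then show ?R by blast
next
  assume ?R
  then have "arc_cut G \<phi> i = {}" for i
    by (fastforce simp: arc_cut_def left_part_def right_part_def)
  then show ?L by simp
qed

lemma d_vsn_eq_0_iff: "d_vsn G = 0 \<longleftrightarrow> acyclic (parcs G)"
proof -
  have "d_vsn G = 0 \<longleftrightarrow>
      (\<exists>\<phi>\<in>layouts G. \<forall>i\<in>{0..card (pverts G)}. card (vsn_cut G \<phi> i) = 0)"
    unfolding d_vsn_def
    by (simp only: Min_nat_image_eq_0_iff[OF d_vsn_range_finite layouts_nonempty]
        pair_digraph_axioms Max_nat_image_eq_0_iff finite_atLeastAtMost atLeastatMost_empty_iff
        not_not le0 not_False_eq_True)
  also have "\<dots> \<longleftrightarrow> acyclic (parcs G)"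
    using vsn_cuts_empty_iff by (auto simp: acyclic_iff_ex_layout)
  finally show ?thesis .
qed

lemma d_cutw_eq_0_iff: "d_cutw G = 0 \<longleftrightarrow> acyclic (parcs G)"
proof -
  have "d_cutw G = 0 \<longleftrightarrow>
      (\<exists>\<phi>\<in>layouts G. \<forall>i\<in>{0..card (pverts G)}. card (arc_cut G \<phi> i) = 0)"
    unfolding d_cutw_def
    by (simp only: Min_nat_image_eq_0_iff[OF d_cutw_range_finite layouts_nonempty]
        pair_digraph_axioms Max_nat_image_eq_0_iff finite_atLeastAtMost atLeastatMost_empty_iff
        not_not le0 not_False_eq_True)
  also have "\<dots> \<longleftrightarrow> (\<exists>\<phi>\<in>layouts G. \<forall>(u, v)\<in>parcs G. \<phi> v < \<phi> u)"
    using arc_cuts_empty_iff by auto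
  also have "\<dots> \<longleftrightarrow> (\<exists>\<phi>\<in>layouts G. \<forall>(u, v)\<in>parcs G. \<phi> u < \<phi> v)"
  proof -
    let ?rev = "\<lambda>\<phi> v. Suc (card (pverts G)) - \<phi> v"
    \<comment> \<open>The bound on positions keeps the truncated subtraction strictly
      decreasing.\<close>
    have "\<forall>(u, v)\<in>parcs G. ?rev \<phi> u < ?rev \<phi> v"
      if "\<phi> \<in> layouts G" "\<forall>(u, v)\<in>parcs G. \<phi> v < \<phi> u" for \<phi>
      using that layout_le_card[OF that(1) in_arcsD1] by (fastforce intro: diff_less_mono2)
    moreover have "\<forall>(u, v)\<in>parcs G. ?rev \<phi> v < ?rev \<phi> u"
      if "\<phi> \<in> layouts G" "\<forall>(u, v)\<in>parcs G. \<phi> u < \<phi> v" for \<phi>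
      using that layout_le_card[OF that(1) in_arcsD2] by (fastforce intro: diff_less_mono2)
    ultimately show ?thesis
      using reverse_layout[of _ G] by meson
  qed
  finally show ?thesis
    by (simp add: acyclic_iff_ex_layout)
qed

section \<open>Directed path decompositions of width 0\<close>

text \<open>Distinct vertices never share a bag. If an arc from \<open>u\<close> to \<open>v\<close>
  failed to increase the first-bag index, then \<open>v\<close> would occur both before and after
  the first bag of \<open>u\<close>, hence in that bag too.\<close>

lemma acyclic_if_small_bags:
  assumes "directed_path_decomposition G Xs" "\<forall>X\<in>set Xs. card X \<le> 1"
  shows "acyclic (parcs G)"
proof -
  have arcs: "\<forall>(u, v)\<in>parcs G. \<exists>i j. i \<le> j \<and> j < length Xs \<and> u \<in> Xs ! i \<and> v \<in> Xs ! j"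
    and interval: "\<And>i j l. i < j \<Longrightarrow> j < l \<Longrightarrow> l < length Xs \<Longrightarrow> Xs ! i \<inter> Xs ! l \<subseteq> Xs ! j"
    using assms(1) by (simp_all add: directed_path_decomposition_def)
  define f where "f v = (LEAST i. i < length Xs \<and> v \<in> Xs ! i)" for v
  have f: "f v < length Xs \<and> v \<in> Xs ! f v" "f v \<le> i"
    if "i < length Xs" "v \<in> Xs ! i" for v i
    using that LeastI[of "\<lambda>i. i < length Xs \<and> v \<in> Xs ! i" i]
      Least_le[of "\<lambda>i. i < length Xs \<and> v \<in> Xs ! i" i] by (auto simp: f_def)
  have bag_eq: "u = v" if "i < length Xs" "u \<in> Xs ! i" "v \<in> Xs ! i" for u v i
  proof -
    have "Xs ! i \<subseteq> pverts G"
      using assms(1) that(1) by (simp add: directed_path_decomposition_def)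
    then have "finite (Xs ! i)"
      using pair_finite_verts finite_subset by blast
    moreover have "card (Xs ! i) \<le> Suc 0"
      using assms(2) that(1) by simp
    ultimately show ?thesis
      using that by (simp add: card_le_Suc0_iff_eq)
  qed
  have "f u < f v" if a: "(u, v) \<in> parcs G" for u v
  proof (rule ccontr)
    assume "\<not> f u < f v"
    then have le: "f v \<le> f u" by simp
    have "u \<noteq> v"
      using a by (rule arc_neq)
    obtain i j where ij: "i \<le> j" "j < length Xs" "u \<in> Xs ! i" "v \<in> Xs ! j"
      using arcs a by fast
    \<comment> \<open>This makes \<open>j\<close> strictly larger than \<open>f u\<close>, since
      \<open>f u \<le> i\<close>.\<close>
    have "i \<noteq> j"
      using ij bag_eq \<open>u \<noteq> v\<close> by blast
    with ij have fu: "f u < length Xs" "u \<in> Xs ! f u" "f u < j"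
      using f[of i u] by auto
    have fv: "f v < length Xs" "v \<in> Xs ! f v"
      using f[of j v] ij by auto
    have "f v \<noteq> f u"
      using fu fv bag_eq \<open>u \<noteq> v\<close> by metis
    with le have "f v < f u" by simp
    then have "Xs ! f v \<inter> Xs ! j \<subseteq> Xs ! f u"
      using interval fu(3) ij(2) by simp
    then have "v \<in> Xs ! f u"
      using fv ij by blast
    then show False
      using bag_eq fu \<open>u \<noteq> v\<close> by blast
  qed
  then show ?thesis
    by (rule acyclic_if_ranking)
qed

text \<open>Bag \<open>0\<close> is empty: the layout positions start at \<open>1\<close>, and the list must be nonempty even for
  the null digraph.\<close>

lemma singleton_bags_decomposition:
  assumes "\<phi> \<in> layouts G" "\<forall>(u, v)\<in>parcs G. \<phi> u < \<phi> v"
  defines "Xs \<equiv> map (\<lambda>i. {v \<in> pverts G. \<phi> v = i}) [0..<Suc (card (pverts G))]"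
  shows "directed_path_decomposition G Xs" "\<forall>X\<in>set Xs. card X \<le> 1"
proof -
  have len: "length Xs = Suc (card (pverts G))"
    by (simp add: Xs_def)
  have nth: "Xs ! i = {v \<in> pverts G. \<phi> v = i}" if "i < Suc (card (pverts G))" for i
    unfolding Xs_def using that by (subst nth_map) (auto simp del: upt_Suc)
  have set: "set Xs = (\<lambda>i. {v \<in> pverts G. \<phi> v = i}) ` {0..card (pverts G)}"
    by (simp add: Xs_def atLeastLessThanSuc_atLeastAtMost del: upt_Suc)
  have inj: "inj_on \<phi> (pverts G)"
    using assms(1) by (simp add: layouts_iff bij_betw_def)
  show "directed_path_decomposition G Xs"
    unfolding directed_path_decomposition_def
  proof (intro conjI)
    show "Xs \<noteq> []"
      using len by auto
    show "\<forall>X\<in>set Xs. X \<subseteq> pverts G"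
      by (auto simp: set)
    show "\<Union> (set Xs) = pverts G"
      using layout_le_card[OF assms(1)] by (auto simp: set)
    show "\<forall>(u, v)\<in>parcs G. \<exists>i j. i \<le> j \<and> j < length Xs \<and> u \<in> Xs ! i \<and> v \<in> Xs ! j"
    proof clarify
      fix u v assume a: "(u, v) \<in> parcs G"
      have "\<phi> u < \<phi> v" "\<phi> v \<le> card (pverts G)"
        using a assms(2) layout_le_card[OF assms(1) in_arcsD2[OF a]] by auto
      then show "\<exists>i j. i \<le> j \<and> j < length Xs \<and> u \<in> Xs ! i \<and> v \<in> Xs ! j"
        using in_arcsD1[OF a] in_arcsD2[OF a]
        by (intro exI[of _ "\<phi> u"] exI[of _ "\<phi> v"]) (simp add: len nth)
    qed
    \<comment> \<open>Bags with different indices are disjoint, so the intersection is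
      empty.\<close>
    show "\<forall>i j l. i < j \<and> j < l \<and> l < length Xs \<longrightarrow> Xs ! i \<inter> Xs ! l \<subseteq> Xs ! j"
      by (auto simp: len nth)
  qed
  have "card {v \<in> pverts G. \<phi> v = i} \<le> 1" for i
    using inj pair_finite_verts by (auto simp: card_le_Suc0_iff_eq dest: inj_onD)
  then show "\<forall>X\<in>set Xs. card X \<le> 1"
    by (auto simp: set)
qed

lemma d_pw_eq_0_iff: "d_pw G = 0 \<longleftrightarrow> acyclic (parcs G)"
proof -
  have "d_pw G = 0 \<longleftrightarrow>
      (\<exists>Xs\<in>{Xs. directed_path_decomposition G Xs}. (MAX X\<in>set Xs. card X) - 1 = 0)"
    unfolding d_pw_def
    using directed_path_decomposition_exists[OF pair_digraph_axioms]
    by (intro Min_nat_image_eq_0_iff[OF d_pw_range_finite[OF pair_digraph_axioms]]) blast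
  also have "\<dots> \<longleftrightarrow> (\<exists>Xs. directed_path_decomposition G Xs \<and> (\<forall>X\<in>set Xs. card X \<le> 1))"
  proof -
    \<comment> \<open>Truncated subtraction lets the maximum be 0 as well as 1, which covers the
      null digraph.\<close>
    have "(MAX X\<in>set Xs. card X) - 1 = 0 \<longleftrightarrow> (\<forall>X\<in>set Xs. card X \<le> 1)"
      if "directed_path_decomposition G Xs" for Xs
    proof -
      have "Xs \<noteq> []"
        using that by (simp add: directed_path_decomposition_def)
      then have "(MAX X\<in>set Xs. card X) \<le> 1 \<longleftrightarrow> (\<forall>X\<in>set Xs. card X \<le> 1)"
        by (subst Max_le_iff) auto
      then show ?thesis by simp
    qed
    then show ?thesis by blast
  qed
  also have "\<dots> \<longleftrightarrow> acyclic (parcs G)"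
  proof
    assume "acyclic (parcs G)"
    then obtain \<phi> where "\<phi> \<in> layouts G" "\<forall>(u, v)\<in>parcs G. \<phi> u < \<phi> v"
      unfolding acyclic_iff_ex_layout ..
    from singleton_bags_decomposition[OF this]
    show "\<exists>Xs. directed_path_decomposition G Xs \<and> (\<forall>X\<in>set Xs. card X \<le> 1)"
      by blast
  qed (use acyclic_if_small_bags in blast)
  finally show ?thesis .
qed

end

theorem theorem6p1:
  fixes G :: "'a pair_pre_digraph"
  assumes "pair_digraph G"
  shows "(dag G \<longleftrightarrow> d_vsn G = 0) \<and> (d_vsn G = 0 \<longleftrightarrow> d_pw G = 0) \<and> (d_pw G = 0 \<longleftrightarrow> d_cutw G = 0)"
proof -
  interpret pair_digraph G by fact
  show ?thesis
    by (simp add: dag_iff_acyclic d_vsn_eq_0_iff d_pw_eq_0_iff d_cutw_eq_0_iff)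
qed

end
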